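(* For every nonnegative integer $n$, $C_1(n)=C_2(n)$, where: (i) $C_1(n)$ is the number of partitions of $n$ into parts congruent to $0$, $1$, $3$, or $5 \pmod 6$; (ii) $C_2(n)$ is the number of partitions of $n$ satisfying all of the following: (a) if two adjacent parts differ by exactly $1$, the smaller of the two is not $\equiv 1 \pmod 3$; (b) if two adjacent parts differ by exactly $2$, the smaller of the two is $\equiv 2 \pmod 3$; (c) no part equals $2$.
   Context: A partition of $n$ is a nonincreasing sequence of positive integers $\lambda_1\ge\lambda_2\ge\cdots\ge\lambda_k\ge1$ with sum $n$. "Adjacent parts" means $\lambda_j$ and $\lambda_{j+1}$ for some $j$, when the parts are written in nonincreasing order. *)

theory Defs
  imports Main
begin

definition partitions :: "nat \<Rightarrow> nat list set" where
  "partitions n = {p. sorted_wrt (\<ge>) p \<and> (\<forall>x\<in>set p. 0 < x) \<and> sum_list p = n}"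

definition C1 :: "nat \<Rightarrow> nat" where
  "C1 n = card {p \<in> partitions n. \<forall>x\<in>set p. x mod 6 \<in> {0, 1, 3, 5}}"

definition C2_cond :: "nat list \<Rightarrow> bool" where
  "C2_cond p \<longleftrightarrow>
     (\<forall>j. Suc j < length p \<longrightarrow>
        (p ! j = p ! Suc j + 1 \<longrightarrow> p ! Suc j mod 3 \<noteq> 1) \<and>
        (p ! j = p ! Suc j + 2 \<longrightarrow> p ! Suc j mod 3 = 2)) \<and>
     2 \<notin> set p"

definition C2 :: "nat \<Rightarrow> nat" where
  "C2 n = card {p \<in> partitions n. C2_cond p}"

end

theory Submission
  imports Defs "HOL-Computational_Algebra.Formal_Power_Series"
begin

text \<open>Put \<open>Q = X\<^sup>3\<close> and let \<open>a\<^sub>n\<close>, \<open>c\<^sub>n\<close> be the generating functions of the partitions of the second kind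
  with all parts less than \<open>3 n\<close>, respectively \<open>3 n + 2\<close>. Removing the largest part gives linear
  recurrences for \<open>a\<^sub>n\<close> and \<open>c\<^sub>n\<close>. For \<open>g(z) = \<Sum>\<^sub>n c\<^sub>n z ^ n\<close> they become a third-order \<open>Q\<close>-difference
  equation, which for \<open>h(z) = g(z) / (-z; Q)\<^sub>\<infinity>\<close> collapses to a two-term recurrence, because
  \<open>1 - s y + s y\<^sup>2 - y\<^sup>3 = (1 - y) (1 - X y) (1 - y / X)\<close> with \<open>s = 1 + X + 1 / X\<close>. Hence \<open>c\<^sub>n\<close> is the sum
  over \<open>j + 2 k = n\<close> of \<open>Q ^ (j choose 2) / (Q; Q)\<^sub>j\<close> times
  \<open>1 / ((Q\<^sup>2; Q\<^sup>2)\<^sub>k (X; Q\<^sup>2)\<^sub>k\<^sub>+\<^sub>1 (X ^ 5; Q\<^sup>2)\<^sub>k)\<close>. As \<open>n\<close> grows, the second factor tends to an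
  infinite product, and the sum of the first one over \<open>j\<close> of a fixed parity tends to
  \<open>(-Q; Q)\<^sub>\<infinity> = 1 / (Q; Q\<^sup>2)\<^sub>\<infinity>\<close>; the product of the two limits enumerates the partitions of the first
  kind.\<close>

section \<open>Partitions as chains\<close>

text \<open>The default \<open>0\<close> acts as a fictitious part after the last one, so that
  \<open>chain\<close> below tests its relation on the last part as well.\<close>

definition hd0 :: "nat list \<Rightarrow> nat" where
  "hd0 p = (case p of [] \<Rightarrow> 0 | x # _ \<Rightarrow> x)"

lemma hd0_simps [simp]: "hd0 [] = 0" "hd0 (x # p) = x"
  by (simp_all add: hd0_def)

fun chain :: "(nat \<Rightarrow> nat \<Rightarrow> bool) \<Rightarrow> nat list \<Rightarrow> bool" where
  "chain R [] \<longleftrightarrow> True"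
| "chain R (x # p) \<longleftrightarrow> 0 < x \<and> hd0 p \<le> x \<and> R x (hd0 p) \<and> chain R p"

definition chains :: "(nat \<Rightarrow> nat \<Rightarrow> bool) \<Rightarrow> nat \<Rightarrow> nat \<Rightarrow> nat list set" where
  "chains R m n = {p. chain R p \<and> hd0 p = m \<and> sum_list p = n}"

definition chain_gf :: "(nat \<Rightarrow> nat \<Rightarrow> bool) \<Rightarrow> nat \<Rightarrow> rat fps" where
  "chain_gf R m = Abs_fps (\<lambda>n. of_nat (card (chains R m n)))"

lemma chain_length_le: "chain R p \<Longrightarrow> length p \<le> sum_list p"
  by (induction p) auto

lemma finite_chains: "finite (chains R m n)"
proof -
  have "chains R m n \<subseteq> {p. set p \<subseteq> {..n} \<and> length p \<le> n}"
    using chain_length_le member_le_sum_list by (fastforce simp: chains_def)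
  then show ?thesis
    by (rule finite_subset) (simp add: finite_lists_length_le)
qed

lemma hd0_le_sum_list: "hd0 p \<le> sum_list p"
  by (cases p) auto

lemma chain_hd0_eq_0: "chain R p \<Longrightarrow> hd0 p = 0 \<longleftrightarrow> p = []"
  by (cases p) auto

lemma chains_0: "chains R 0 n = (if n = 0 then {[]} else {})"
  using chain_hd0_eq_0 by (auto simp: chains_def)

lemma chains_pos:
  assumes "0 < m"
  shows "chains R m n =
    (if m \<le> n then (#) m ` (\<Union>y\<in>{y. y \<le> m \<and> R m y}. chains R y (n - m)) else {})"
    (is "_ = ?r")
proof
  show "chains R m n \<subseteq> ?r"
  proof
    fix p assume "p \<in> chains R m n"
    then obtain p' where "p = m # p'" "hd0 p' \<le> m" "R m (hd0 p')" "chain R p'" "n = m + sum_list p'"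
      using assms by (cases p) (auto simp: chains_def)
    then show "p \<in> ?r"
      by (auto simp: chains_def)
  qed
  show "?r \<subseteq> chains R m n"
    using assms by (auto simp: chains_def split: if_splits)
qed

lemma chain_gf_0: "chain_gf R 0 = 1"
  by (rule fps_ext) (simp add: chain_gf_def chains_0)

text \<open>Classify the chains by the part \<open>y\<close> that follows the largest part
  \<open>m\<close>; deleting \<open>m\<close> lowers the sum by \<open>m\<close>.\<close>

lemma chain_gf_pos:
  assumes "0 < m"
  shows "chain_gf R m = fps_X ^ m * (\<Sum>y | y \<le> m \<and> R m y. chain_gf R y)"
proof (rule fps_ext)
  fix n
  have "card (\<Union>y\<in>{y. y \<le> m \<and> R m y}. chains R y k) = (\<Sum>y | y \<le> m \<and> R m y. card (chains R y k))"
    for k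
    by (rule card_UN_disjoint) (auto simp: finite_chains, auto simp: chains_def)
  then have "card (chains R m n) = (if m \<le> n then \<Sum>y | y \<le> m \<and> R m y. card (chains R y (n - m)) else 0)"
    by (simp add: chains_pos [OF assms] card_image)
  then show "fps_nth (chain_gf R m) n = fps_nth (fps_X ^ m * (\<Sum>y | y \<le> m \<and> R m y. chain_gf R y)) n"
    by (simp add: chain_gf_def fps_X_power_mult_nth fps_sum_nth)
qed

lemma chain_gf_refl:
  assumes "0 < m" "R m m"
  shows "(1 - fps_X ^ m) * chain_gf R m = fps_X ^ m * (\<Sum>y | y < m \<and> R m y. chain_gf R y)"
proof -
  have "{y. y \<le> m \<and> R m y} = insert m {y. y < m \<and> R m y}"
    using assms by auto
  then have "chain_gf R m = fps_X ^ m * (chain_gf R m + (\<Sum>y | y < m \<and> R m y. chain_gf R y))"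
    using chain_gf_pos [OF assms(1), of R] by simp
  then show ?thesis
    by (simp add: algebra_simps)
qed

text \<open>A head never exceeds the sum, so finitely many heads account for each coefficient and no
  infinite sum is formed.\<close>

lemma card_chain_sum_list:
  assumes "n < M"
  shows "of_nat (card {p. chain R p \<and> sum_list p = n}) = fps_nth (\<Sum>m<M. chain_gf R m) n"
proof -
  have "{p. chain R p \<and> sum_list p = n} = (\<Union>m\<in>{..<M}. chains R m n)"
    using assms hd0_le_sum_list le_less_trans by (fastforce simp: chains_def)
  moreover have "card (\<Union>m\<in>{..<M}. chains R m n) = (\<Sum>m<M. card (chains R m n))"
    by (rule card_UN_disjoint) (auto simp: finite_chains, auto simp: chains_def)
  ultimately show ?thesis
    by (simp add: chain_gf_def fps_sum_nth)
qed

section \<open>The two families of partitions as chains\<close>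

definition R1 :: "nat \<Rightarrow> nat \<Rightarrow> bool" where
  "R1 = (\<lambda>x y. x mod 6 \<in> {0, 1, 3, 5})"

definition R2 :: "nat \<Rightarrow> nat \<Rightarrow> bool" where
  "R2 x y \<longleftrightarrow> (x = y + 1 \<longrightarrow> y mod 3 \<noteq> 1) \<and> (x = y + 2 \<longrightarrow> y mod 3 = 2)"

lemma chain_sorted_pos:
  "chain R p \<Longrightarrow> sorted_wrt (\<ge>) p \<and> (\<forall>x\<in>set p. 0 < x \<and> x \<le> hd0 p)"
  by (induction p) auto

lemma hd0_le: "\<forall>y\<in>set p. y \<le> x \<Longrightarrow> hd0 p \<le> x"
  by (cases p) auto

lemma chain_unary_iff:
  "chain (\<lambda>x y. P x) p \<longleftrightarrow> sorted_wrt (\<ge>) p \<and> (\<forall>x\<in>set p. 0 < x) \<and> (\<forall>x\<in>set p. P x)"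
proof (induction p)
  case (Cons x p)
  then show ?case
    using chain_sorted_pos [of "\<lambda>x y. P x" p] hd0_le [of p x] by (auto intro: le_trans)
qed simp

lemma chain_R1_iff:
  "chain R1 p \<longleftrightarrow>
    sorted_wrt (\<ge>) p \<and> (\<forall>x\<in>set p. 0 < x) \<and> (\<forall>x\<in>set p. x mod 6 \<in> {0, 1, 3, 5})"
  unfolding R1_def by (rule chain_unary_iff)

text \<open>With a fictitious last part \<open>0\<close>, the exclusion of the part \<open>2\<close> is an instance of the
  condition on adjacent parts that differ by \<open>2\<close>.\<close>

lemma C2_cond_Cons:
  assumes "\<forall>y\<in>set p. 0 < y" "hd0 p \<le> x"
  shows "C2_cond (x # p) \<longleftrightarrow> R2 x (hd0 p) \<and> C2_cond p"
proof (cases p)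
  case Nil
  then show ?thesis by (auto simp: C2_cond_def R2_def)
next
  case (Cons y p')
  have step: "(\<forall>j. Suc j < length (x # p) \<longrightarrow> P ((x # p) ! j) ((x # p) ! Suc j)) \<longleftrightarrow>
      P x y \<and> (\<forall>j. Suc j < length p \<longrightarrow> P (p ! j) (p ! Suc j))" for P
    using Cons by (auto simp: nth_Cons split: nat.splits)
  \<comment> \<open>If \<open>x = 2\<close>, then \<open>y\<close> is \<open>1\<close> or
    \<open>2\<close>, and \<open>R2 2 1\<close> fails. So only the part \<open>2\<close> inside
    \<open>p\<close> remains to be excluded.\<close>
  have "R2 x y \<Longrightarrow> y \<noteq> 2 \<Longrightarrow> x \<noteq> 2"
    using assms Cons by (cases "y = 1") (auto simp: R2_def)
  then show ?thesis
    using step [of R2] Cons by (auto simp: C2_cond_def R2_def)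
qed

lemma chain_R2_iff:
  "chain R2 p \<longleftrightarrow> sorted_wrt (\<ge>) p \<and> (\<forall>x\<in>set p. 0 < x) \<and> C2_cond p"
proof (induction p)
  case Nil
  then show ?case by (simp add: C2_cond_def)
next
  case (Cons x p)
  then show ?case
    using chain_sorted_pos [of R2 p] hd0_le [of p x] C2_cond_Cons [of p x]
    by (auto intro: le_trans)
qed

lemma C1_eq: "n < M \<Longrightarrow> of_nat (C1 n) = fps_nth (\<Sum>m<M. chain_gf R1 m) n"
  by (subst card_chain_sum_list [symmetric])
    (auto simp: C1_def partitions_def chain_R1_iff intro!: arg_cong [where f = card])

lemma C2_eq: "n < M \<Longrightarrow> of_nat (C2 n) = fps_nth (\<Sum>m<M. chain_gf R2 m) n"
  by (subst card_chain_sum_list [symmetric])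
    (auto simp: C2_def partitions_def chain_R2_iff intro!: arg_cong [where f = card])

section \<open>Recurrences for the generating functions with bounded largest part\<close>

abbreviation X :: "rat fps" where "X \<equiv> fps_X"

abbreviation gf1 :: "nat \<Rightarrow> rat fps" where "gf1 M \<equiv> \<Sum>m<M. chain_gf R1 m"

abbreviation gf2 :: "nat \<Rightarrow> rat fps" where "gf2 M \<equiv> \<Sum>m<M. chain_gf R2 m"

lemma one_minus_X_power_neq_0: "0 < m \<Longrightarrow> 1 - X ^ m \<noteq> 0"
  by (auto simp: fps_eq_iff fps_X_power_iff intro!: exI [of _ 0])

lemma inverse_mult_one_minus_X_power: "0 < m \<Longrightarrow> (1 - X ^ m) * inverse (1 - X ^ m) = 1"
  by (subst mult.commute, rule inverse_mult_eq_1) simp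

lemma one_minus_X_power_cancel: "(1 - X ^ m) * f = (1 - X ^ m) * g \<Longrightarrow> 0 < m \<Longrightarrow> f = g"
  using one_minus_X_power_neq_0 [of m] by simp

lemma gf1_step:
  assumes "0 < m"
  shows "m mod 6 \<in> {0, 1, 3, 5} \<Longrightarrow> (1 - X ^ m) * gf1 (Suc m) = gf1 m"
    and "m mod 6 \<notin> {0, 1, 3, 5} \<Longrightarrow> gf1 (Suc m) = gf1 m"
proof -
  assume "m mod 6 \<in> {0, 1, 3, 5}"
  then have "R1 m y" for y by (simp add: R1_def)
  then have "(1 - X ^ m) * chain_gf R1 m = X ^ m * gf1 m"
    using chain_gf_refl [of m R1] assms by (simp add: lessThan_def)
  then show "(1 - X ^ m) * gf1 (Suc m) = gf1 m"
    by (simp add: algebra_simps)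
next
  assume "m mod 6 \<notin> {0, 1, 3, 5}"
  then have "\<not> R1 m y" for y by (simp add: R1_def)
  then have "chain_gf R1 m = 0"
    using chain_gf_pos [of m R1] assms by simp
  then show "gf1 (Suc m) = gf1 m" by simp
qed

lemma gf1_6_step:
  "(1 - X ^ (6 * n + 3)) * (1 - X ^ (6 * n + 5)) * (1 - X ^ (6 * n + 6)) * (1 - X ^ (6 * n + 7)) *
    gf1 (6 * Suc n + 2) = gf1 (6 * n + 2)"
proof -
  have m: "(6 * n + 2) mod 6 = 2" "(6 * n + 3) mod 6 = 3" "(6 * n + 4) mod 6 = 4"
    "(6 * n + 5) mod 6 = 5" "(6 * n + 6) mod 6 = 0" "(6 * n + 7) mod 6 = 1"
    by presburger+
  have i: "Suc (6 * n + 2) = 6 * n + 3" "Suc (6 * n + 3) = 6 * n + 4" "Suc (6 * n + 4) = 6 * n + 5"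
    "Suc (6 * n + 5) = 6 * n + 6" "Suc (6 * n + 6) = 6 * n + 7" "Suc (6 * n + 7) = 6 * n + 8"
    by simp_all
  have "gf1 (6 * n + 3) = gf1 (6 * n + 2)"
    using gf1_step(2) [of "6 * n + 2"] unfolding m i by simp
  moreover have "(1 - X ^ (6 * n + 3)) * gf1 (6 * n + 4) = gf1 (6 * n + 3)"
    using gf1_step(1) [of "6 * n + 3"] unfolding m i by simp
  moreover have "gf1 (6 * n + 5) = gf1 (6 * n + 4)"
    using gf1_step(2) [of "6 * n + 4"] unfolding m i by simp
  moreover have "(1 - X ^ (6 * n + 5)) * gf1 (6 * n + 6) = gf1 (6 * n + 5)"
    using gf1_step(1) [of "6 * n + 5"] unfolding m i by simp
  moreover have "(1 - X ^ (6 * n + 6)) * gf1 (6 * n + 7) = gf1 (6 * n + 6)"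
    using gf1_step(1) [of "6 * n + 6"] unfolding m i by simp
  moreover have "(1 - X ^ (6 * n + 7)) * gf1 (6 * n + 8) = gf1 (6 * n + 7)"
    using gf1_step(1) [of "6 * n + 7"] unfolding m i by simp
  moreover have "6 * Suc n + 2 = 6 * n + 8" by simp
  ultimately show ?thesis by (metis (no_types, lifting) mult.assoc)
qed

text \<open>Only differences 1 and 2 can be forbidden. Below \<open>3 k + 1\<close> nothing is;
  below \<open>3 k + 2\<close> both \<open>3 k\<close> and \<open>3 k + 1\<close> are; below
  \<open>3 k + 3\<close> only \<open>3 k + 1\<close> is. For \<open>k = 0\<close> the second
  equation forces the value 0, which rules out the part \<open>2\<close>.\<close>

lemma gf2_steps:
  shows "(1 - X ^ (3 * k + 1)) * chain_gf R2 (3 * k + 1) = X ^ (3 * k + 1) * gf2 (3 * k + 1)"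
    and "(1 - X ^ (3 * k + 2)) * chain_gf R2 (3 * k + 2) = X ^ (3 * k + 2) * gf2 (3 * k)"
    and "(1 - X ^ (3 * k + 3)) * chain_gf R2 (3 * k + 3) =
      X ^ (3 * k + 3) * (gf2 (3 * k + 3) - chain_gf R2 (3 * k + 1))"
proof -
  have "y = 3 * k \<Longrightarrow> y mod 3 \<noteq> 1" "3 * k + 1 = y + 2 \<Longrightarrow> y mod 3 = 2" for y
    by presburger+
  then have s: "{y. y < 3 * k + 1 \<and> R2 (3 * k + 1) y} = {..<3 * k + 1}"
    by (auto simp: R2_def)
  show "(1 - X ^ (3 * k + 1)) * chain_gf R2 (3 * k + 1) = X ^ (3 * k + 1) * gf2 (3 * k + 1)"
    using chain_gf_refl [of "3 * k + 1" R2] unfolding s by (simp add: R2_def)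
  have R2_iff: "R2 (3 * k + 2) y \<longleftrightarrow> y \<noteq> 3 * k \<and> y \<noteq> 3 * k + 1" for y
    by (auto simp: R2_def)
  have s: "{y. y < 3 * k + 2 \<and> R2 (3 * k + 2) y} = {..<3 * k}"
    unfolding R2_iff by auto
  show "(1 - X ^ (3 * k + 2)) * chain_gf R2 (3 * k + 2) = X ^ (3 * k + 2) * gf2 (3 * k)"
    using chain_gf_refl [of "3 * k + 2" R2] unfolding s by (simp add: R2_def)
  have R2_iff: "R2 (3 * k + 3) y \<longleftrightarrow> y \<noteq> 3 * k + 1" for y
    unfolding R2_def by presburger
  have s: "{y. y < 3 * k + 3 \<and> R2 (3 * k + 3) y} = {..<3 * k + 3} - {3 * k + 1}"
    unfolding R2_iff by auto
  have "gf2 (3 * k + 3) - chain_gf R2 (3 * k + 1) = sum (chain_gf R2) ({..<3 * k + 3} - {3 * k + 1})"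
    by (subst sum_diff1) auto
  then show "(1 - X ^ (3 * k + 3)) * chain_gf R2 (3 * k + 3) =
      X ^ (3 * k + 3) * (gf2 (3 * k + 3) - chain_gf R2 (3 * k + 1))"
    using chain_gf_refl [of "3 * k + 3" R2] unfolding s by (simp add: R2_def)
qed

lemma gf2_recurrences:
  defines "a \<equiv> \<lambda>k. gf2 (3 * k)" and "c \<equiv> \<lambda>k. gf2 (3 * k + 2)"
  shows "(1 - X ^ (3 * k + 2)) * a (Suc k) = (1 - X ^ (3 * k + 2)) * c k + X ^ (3 * k + 2) * a k"
    and "(1 - X ^ (3 * k + 4)) * (1 - X ^ (3 * k + 3)) * c (Suc k) = a (Suc k) - X ^ (6 * k + 4) * c k"
proof -
  have a: "a (Suc k) = c k + chain_gf R2 (3 * k + 2)" for k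
    by (simp add: a_def c_def eval_nat_numeral)
  show "(1 - X ^ (3 * k + 2)) * a (Suc k) = (1 - X ^ (3 * k + 2)) * c k + X ^ (3 * k + 2) * a k"
    using gf2_steps(2) [of k] unfolding a by (simp only: a_def distrib_left)
  have c: "c k = gf2 (3 * k + 1) + chain_gf R2 (3 * k + 1)" for k
    by (simp add: c_def)
  have cb: "(1 - X ^ (3 * k + 1)) * c k = gf2 (3 * k + 1)" for k
    using gf2_steps(1) [of k] unfolding c by (simp add: algebra_simps)
  \<comment> \<open>Deleting one copy of the largest part \<open>3 k + 1\<close> leaves any chain
    with parts at most \<open>3 k + 1\<close>, and \<open>c k\<close> enumerates these.\<close>
  have "(1 - X ^ (3 * k + 1)) * chain_gf R2 (3 * k + 1) = (1 - X ^ (3 * k + 1)) * (X ^ (3 * k + 1) * c k)"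
    using gf2_steps(1) [of k] unfolding cb [symmetric] by (simp only: mult_ac)
  then have L: "chain_gf R2 (3 * k + 1) = X ^ (3 * k + 1) * c k"
    by (rule one_minus_X_power_cancel) simp
  have i: "3 * k + 3 + 1 = 3 * k + 4" "3 * Suc k = 3 * k + 3" "Suc (3 * k + 3) = 3 * k + 4"
    by simp_all
  have "(1 - X ^ (3 * k + 4)) * c (Suc k) = gf2 (3 * k + 4)"
    using cb [of "Suc k"] unfolding i .
  also have "\<dots> = a (Suc k) + chain_gf R2 (3 * k + 3)"
    using sum.lessThan_Suc [of "chain_gf R2" "3 * k + 3"] unfolding a_def i .
  finally have "(1 - X ^ (3 * k + 3)) * ((1 - X ^ (3 * k + 4)) * c (Suc k)) =
     (1 - X ^ (3 * k + 3)) * a (Suc k) + (1 - X ^ (3 * k + 3)) * chain_gf R2 (3 * k + 3)"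
    by (simp only: distrib_left)
  also have "(1 - X ^ (3 * k + 3)) * chain_gf R2 (3 * k + 3) =
      X ^ (3 * k + 3) * (a (Suc k) - X ^ (3 * k + 1) * c k)"
    using gf2_steps(3) [of k] unfolding L a_def i .
  also have "(1 - X ^ (3 * k + 3)) * a (Suc k) + X ^ (3 * k + 3) * (a (Suc k) - X ^ (3 * k + 1) * c k) =
     a (Suc k) - X ^ ((3 * k + 3) + (3 * k + 1)) * c k"
    unfolding power_add [of X "3 * k + 3"] by (simp only: algebra_simps) simp
  also have "(3 * k + 3) + (3 * k + 1) = 6 * k + 4" by simp
  finally show "(1 - X ^ (3 * k + 4)) * (1 - X ^ (3 * k + 3)) * c (Suc k) = a (Suc k) - X ^ (6 * k + 4) * c k"
    by (simp only: mult_ac)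
qed

section \<open>Solution of the recurrences\<close>

text \<open>Here \<open>e j\<close> is \<open>Q ^ (j choose 2) / (Q; Q)\<^sub>j\<close>, the coefficient of \<open>z ^ j\<close> in Euler's
  product \<open>(-z; Q)\<^sub>\<infinity>\<close>, and \<open>W k\<close> is \<open>1 / ((Q\<^sup>2; Q\<^sup>2)\<^sub>k (X; Q\<^sup>2)\<^sub>k\<^sub>+\<^sub>1 (X ^ 5; Q\<^sup>2)\<^sub>k)\<close>.\<close>

primrec e :: "nat \<Rightarrow> rat fps" where
  "e 0 = 1"
| "e (Suc j) = X ^ (3 * j) * e j * inverse (1 - X ^ (3 * Suc j))"

primrec W :: "nat \<Rightarrow> rat fps" where
  "W 0 = inverse (1 - X)"
| "W (Suc k) = W k * inverse (1 - X ^ (6 * k + 5)) * inverse (1 - X ^ (6 * k + 6)) *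
    inverse (1 - X ^ (6 * k + 7))"

text \<open>A stage between \<open>W k\<close> and \<open>W (Suc k)\<close>: sums that involve one
  or the other become comparable summand by summand in terms of \<open>V k\<close>.\<close>

definition V :: "nat \<Rightarrow> rat fps" where
  "V k = W k * inverse (1 - X ^ (6 * k + 5))"

lemma e_Suc_mult: "(1 - X ^ (3 * Suc j)) * e (Suc j) = X ^ (3 * j) * e j"
proof -
  have "(1 - X ^ (3 * Suc j)) * e (Suc j) =
      X ^ (3 * j) * e j * ((1 - X ^ (3 * Suc j)) * inverse (1 - X ^ (3 * Suc j)))"
    by (simp only: e.simps mult_ac)
  then show ?thesis
    by (subst (asm) inverse_mult_one_minus_X_power) auto
qed

lemma W_eq_V: "W k = (1 - X ^ (6 * k + 5)) * V k"
proof -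
  have "(1 - X ^ (6 * k + 5)) * V k = W k * ((1 - X ^ (6 * k + 5)) * inverse (1 - X ^ (6 * k + 5)))"
    by (simp only: V_def mult_ac)
  then show ?thesis
    by (subst (asm) inverse_mult_one_minus_X_power) auto
qed

lemma W_Suc_eq_V: "(1 - X ^ (6 * k + 6)) * (1 - X ^ (6 * k + 7)) * W (Suc k) = V k"
proof -
  have "(1 - X ^ (6 * k + 6)) * (1 - X ^ (6 * k + 7)) * W (Suc k) =
     V k * ((1 - X ^ (6 * k + 6)) * inverse (1 - X ^ (6 * k + 6))) *
       ((1 - X ^ (6 * k + 7)) * inverse (1 - X ^ (6 * k + 7)))"
    by (simp only: W.simps V_def mult_ac)
  then show ?thesis
    by (simp only: inverse_mult_one_minus_X_power add_pos_pos zero_less_numeral add_gr_0 simp_thms mult_1_right)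
qed

lemma W_Suc_mult:
  "(1 - X ^ (6 * k + 5)) * (1 - X ^ (6 * k + 6)) * (1 - X ^ (6 * k + 7)) * W (Suc k) = W k"
  using W_Suc_eq_V [of k] W_eq_V [of k] by (simp only: mult.assoc)

section \<open>Closed forms of \<open>c\<^sub>n\<close> and \<open>a\<^sub>n\<close>\<close>

definition csol :: "nat \<Rightarrow> rat fps" where
  "csol n = (\<Sum>k\<le>n div 2. e (n - 2 * k) * W k)"

text \<open>\<open>asol1 n + asol2 n\<close> is the closed form of \<open>a\<^sub>n\<close>. With
  \<open>u = X ^ (3 * j)\<close>, \<open>v = X ^ (6 * k)\<close> and \<open>j + 2 * k = n\<close>,
  the factor \<open>1 - u\<close> in \<open>asol1\<close> lowers the index of \<open>e\<close>, and
  \<open>(1 - v) * (1 - v * X)\<close> in \<open>asol2\<close> lowers that of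
  \<open>W\<close>.\<close>

definition asol1 :: "nat \<Rightarrow> rat fps" where
  "asol1 n = (\<Sum>k\<le>n div 2. (1 - X ^ (3 * (n - 2 * k))) * e (n - 2 * k) * W k)"

definition asol2 :: "nat \<Rightarrow> rat fps" where
  "asol2 n = (\<Sum>k\<le>n div 2. X ^ (3 * (n - 2 * k)) * e (n - 2 * k) *
     ((1 - X ^ (6 * k)) * (1 - X ^ (6 * k + 1)) * W k))"

text \<open>Termwise this is \<open>e_Suc_mult\<close>. It moves a sum from total index
  \<open>Suc n\<close> to \<open>n\<close>, which brings the recurrences to a common index.\<close>

lemma e_shift:
  "(\<Sum>k\<le>Suc n div 2. (1 - X ^ (3 * (Suc n - 2 * k))) * e (Suc n - 2 * k) * F k) =
    (\<Sum>k\<le>n div 2. X ^ (3 * (n - 2 * k)) * e (n - 2 * k) * F k)" (is "sum ?f _ = sum ?g _")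
proof -
  have fg: "?f k = ?g k" if "k \<le> n div 2" for k
  proof -
    have "Suc n - 2 * k = Suc (n - 2 * k)"
      using that by linarith
    then show ?thesis
      by (simp only: e_Suc_mult)
  qed
  \<comment> \<open>For odd \<open>n\<close> the range gains one index \<open>k\<close>, but there
    \<open>Suc n - 2 * k = 0\<close> and the factor \<open>1 - X ^ 0\<close> vanishes.\<close>
  have "sum ?f {..Suc n div 2} = sum ?f {..n div 2}"
  proof (cases "even n")
    case False
    then have "Suc n div 2 = Suc (n div 2)" "Suc n - 2 * Suc (n div 2) = 0"
      by presburger+
    then show ?thesis by simp
  qed simp
  also have "\<dots> = sum ?g {..n div 2}"
    by (rule sum.cong [OF refl], rule fg) simp
  finally show ?thesis .
qed

lemma asol1_Suc: "asol1 (Suc n) = (\<Sum>k\<le>n div 2. X ^ (3 * (n - 2 * k)) * e (n - 2 * k) * W k)"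
  unfolding asol1_def by (rule e_shift)

text \<open>The summand \<open>k = 0\<close> vanishes because of \<open>1 - X ^ 0\<close>; the
  others are shifted by \<open>W_Suc_eq_V\<close>.\<close>

lemma asol2_Suc_Suc: "asol2 (Suc (Suc n)) = (\<Sum>k\<le>n div 2. X ^ (3 * (n - 2 * k)) * e (n - 2 * k) * V k)"
proof -
  have d: "Suc (Suc n) div 2 = Suc (n div 2)" by simp
  have "(1 - X ^ (6 * Suc k)) * (1 - X ^ (6 * Suc k + 1)) * W (Suc k) = V k" for k
    using W_Suc_eq_V [of k] by (simp add: algebra_simps)
  moreover have "Suc (Suc n) - 2 * Suc k = n - 2 * k" for k by simp
  ultimately show ?thesis
    unfolding asol2_def d by (subst sum.atMost_Suc_shift) simp
qed

lemma asol2_Suc: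
  "asol2 (Suc n) = (\<Sum>k\<le>n div 2. (1 - X ^ (3 * (n - 2 * k))) * e (n - 2 * k) * V k)"
proof (cases n)
  case 0
  then show ?thesis by (simp add: asol2_def)
next
  case (Suc m)
  then show ?thesis
    by (simp only: e_shift asol2_Suc_Suc)
qed

text \<open>Prepares \<open>asol_csol_1\<close>, where the summands must carry \<open>V k\<close>
  with \<open>j + 2 * k = n\<close>. \<open>asol2_Suc_Suc\<close> has total index
  \<open>n - 2\<close>, and two uses of \<open>e_shift\<close> bridge the gap; for
  \<open>n \<le> 1\<close> both sides are 0.\<close>

lemma asol2_mult:
  "X ^ (3 * n + 2) * asol2 n =
    (\<Sum>k\<le>n div 2. (1 - X ^ (3 * (n - 2 * k))) * e (n - 2 * k) *
      (X ^ (6 * k + 2) * (X ^ 3 - X ^ (3 * (n - 2 * k))) * V k))" (is "_ = ?r n")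
proof -
  consider "n = 0" | "n = 1" | m where "n = Suc (Suc m)"
    by (metis One_nat_def not0_implies_Suc)
  then show ?thesis
  proof cases
    case 3
    \<comment> \<open>With \<open>u = X ^ (3 * l)\<close>, the factor \<open>Q - Q * u\<close>
      supplies the \<open>1 - u\<close> needed for the second shift, and
      \<open>u * Q * w = X ^ (3 * m + 8)\<close> is free of \<open>k\<close>.\<close>
    have ring: "u * x * (w * (Q - Q * u) * y) = (1 - u) * x * (u * Q * w * y)" for u x w Q y :: "rat fps"
      by (simp add: algebra_simps)
    have "?r n = (\<Sum>k\<le>Suc m div 2. X ^ (3 * (Suc m - 2 * k)) * e (Suc m - 2 * k) *
        (X ^ (6 * k + 2) * (X ^ 3 - X ^ (3 * (n - 2 * k))) * V k))"
      unfolding 3 by (rule e_shift)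
    also have "\<dots> = (\<Sum>k\<le>Suc m div 2. (1 - X ^ (3 * (Suc m - 2 * k))) * e (Suc m - 2 * k) *
        (X ^ (3 * m + 8) * V k))"
    proof (rule sum.cong)
      fix k assume "k \<in> {..Suc m div 2}"
      then have k: "2 * k \<le> Suc m" by auto
      define l where "l = Suc m - 2 * k"
      have l: "Suc m - 2 * k = l" "3 * (n - 2 * k) = 3 + 3 * l" "3 * m + 8 = 3 * l + 3 + (6 * k + 2)"
        using k by (auto simp: l_def 3)
      show "X ^ (3 * (Suc m - 2 * k)) * e (Suc m - 2 * k) *
          (X ^ (6 * k + 2) * (X ^ 3 - X ^ (3 * (n - 2 * k))) * V k) =
        (1 - X ^ (3 * (Suc m - 2 * k))) * e (Suc m - 2 * k) * (X ^ (3 * m + 8) * V k)"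
        unfolding l power_add [of X 3] power_add [of X "3 * l + 3"] power_add [of X "3 * l" 3]
        by (rule ring)
    qed simp
    also have "\<dots> = (\<Sum>k\<le>m div 2. X ^ (3 * (m - 2 * k)) * e (m - 2 * k) * (X ^ (3 * m + 8) * V k))"
      by (rule e_shift)
    also have "\<dots> = X ^ (3 * n + 2) * asol2 n"
    proof -
      have "3 * n + 2 = 3 * m + 8" using 3 by simp
      then show ?thesis
        unfolding 3 asol2_Suc_Suc sum_distrib_left by (simp only: mult_ac)
    qed
    finally show ?thesis ..
  qed (simp_all add: asol2_def)
qed

text \<open>After the shifts all sums run over \<open>j + 2 * k = n\<close>, and the claim holds
  summand by summand: \<open>ring\<close> is used with \<open>u = X ^ (3 * j)\<close>,
  \<open>w = X ^ (6 * k + 2)\<close>, \<open>Q = X ^ 3\<close>, \<open>y = V k\<close>.\<close>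

lemma asol_csol_1:
  "(1 - X ^ (3 * n + 2)) * (asol1 (Suc n) + asol2 (Suc n)) =
    (1 - X ^ (3 * n + 2)) * csol n + X ^ (3 * n + 2) * (asol1 n + asol2 n)"
proof -
  have ring: "(1 - u * w) * (u * x * ((1 - Q * w) * y) + (1 - u) * x * y) =
      (1 - u * w) * (x * ((1 - Q * w) * y)) + u * w * ((1 - u) * x * ((1 - Q * w) * y)) +
        (1 - u) * x * (w * (Q - u) * y)" for u w x y Q :: "rat fps"
    by (simp add: algebra_simps)
  have "(1 - X ^ (3 * n + 2)) *
      (X ^ (3 * (n - 2 * k)) * e (n - 2 * k) * W k + (1 - X ^ (3 * (n - 2 * k))) * e (n - 2 * k) * V k) =
    (1 - X ^ (3 * n + 2)) * (e (n - 2 * k) * W k) +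
    X ^ (3 * n + 2) * ((1 - X ^ (3 * (n - 2 * k))) * e (n - 2 * k) * W k) +
    (1 - X ^ (3 * (n - 2 * k))) * e (n - 2 * k) * (X ^ (6 * k + 2) * (X ^ 3 - X ^ (3 * (n - 2 * k))) * V k)"
    if "k \<le> n div 2" for k
  proof -
    have p: "3 * n + 2 = 3 * (n - 2 * k) + (6 * k + 2)" "6 * k + 5 = 3 + (6 * k + 2)"
      using that by linarith+
    show ?thesis
      unfolding W_eq_V [of k] p power_add [of X "3 * (n - 2 * k)" "6 * k + 2"]
        power_add [of X 3 "6 * k + 2"] by (rule ring)
  qed
  then have "(\<Sum>k\<le>n div 2. (1 - X ^ (3 * n + 2)) *
      (X ^ (3 * (n - 2 * k)) * e (n - 2 * k) * W k + (1 - X ^ (3 * (n - 2 * k))) * e (n - 2 * k) * V k)) =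
    (\<Sum>k\<le>n div 2. (1 - X ^ (3 * n + 2)) * (e (n - 2 * k) * W k) +
    X ^ (3 * n + 2) * ((1 - X ^ (3 * (n - 2 * k))) * e (n - 2 * k) * W k) +
    (1 - X ^ (3 * (n - 2 * k))) * e (n - 2 * k) * (X ^ (6 * k + 2) * (X ^ 3 - X ^ (3 * (n - 2 * k))) * V k))"
    by (intro sum.cong) auto
  then show ?thesis
    unfolding distrib_left [of "X ^ (3 * n + 2)"] asol2_mult asol1_Suc asol2_Suc asol1_def [of n] csol_def
    by (simp only: sum.distrib sum_distrib_left [symmetric] add.assoc)
qed

lemma asol_csol_2:
  "(1 - X ^ (3 * n + 4)) * (1 - X ^ (3 * n + 3)) * csol (Suc n) =
    asol1 (Suc n) + asol2 (Suc n) - X ^ (6 * n + 4) * csol n"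
proof -
  \<comment> \<open>At total index \<open>Suc n\<close>, with \<open>a = X\<close>, the first two
    terms on the right yield \<open>asol1\<close> and \<open>asol2\<close>, and the third yields
    \<open>X ^ (6 * n + 4) * csol n\<close>.\<close>
  have ring: "(1 - u * v * a) * (1 - u * v) * (x * y) =
      (1 - u) * x * y + u * x * ((1 - v) * (1 - v * a) * y) - (1 - u) * x * (u * v * a * v * y)"
    for u v x y a :: "rat fps"
    by (simp add: algebra_simps)
  \<comment> \<open>Splitting off \<open>X ^ (3 * j)\<close> makes \<open>e_shift\<close>
    applicable, which carries \<open>csol n\<close> to total index \<open>Suc n\<close>.\<close>
  have "X ^ (6 * n + 4) * csol n =
      (\<Sum>k\<le>n div 2. X ^ (3 * (n - 2 * k)) * e (n - 2 * k) * (X ^ (3 * n + 4 + 6 * k) * W k))"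
    unfolding csol_def sum_distrib_left
  proof (rule sum.cong)
    fix k assume "k \<in> {..n div 2}"
    then have "6 * n + 4 = 3 * (n - 2 * k) + (3 * n + 4 + 6 * k)"
      by auto
    then have "X ^ (6 * n + 4) = X ^ (3 * (n - 2 * k)) * X ^ (3 * n + 4 + 6 * k)"
      by (simp only: power_add)
    then show "X ^ (6 * n + 4) * (e (n - 2 * k) * W k) =
        X ^ (3 * (n - 2 * k)) * e (n - 2 * k) * (X ^ (3 * n + 4 + 6 * k) * W k)"
      by (simp only: mult_ac)
  qed simp
  also have "\<dots> = (\<Sum>k\<le>Suc n div 2. (1 - X ^ (3 * (Suc n - 2 * k))) * e (Suc n - 2 * k) *
      (X ^ (3 * n + 4 + 6 * k) * W k))"
    by (rule e_shift [symmetric])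
  finally have c: "X ^ (6 * n + 4) * csol n = \<dots>" .
  show ?thesis
    unfolding c unfolding asol1_def asol2_def csol_def sum_distrib_left sum.distrib [symmetric] sum_subtractf [symmetric]
  proof (rule sum.cong)
    fix k assume "k \<in> {..Suc n div 2}"
    then have "2 * k \<le> Suc n" by auto
    then have "3 * n + 4 = 3 * (Suc n - 2 * k) + 6 * k + 1" "3 * n + 3 = 3 * (Suc n - 2 * k) + 6 * k"
      by auto
    then have p: "X ^ (3 * n + 4) = X ^ (3 * (Suc n - 2 * k)) * X ^ (6 * k) * X"
       "X ^ (3 * n + 3) = X ^ (3 * (Suc n - 2 * k)) * X ^ (6 * k)"
       "X ^ (3 * n + 4 + 6 * k) = X ^ (3 * (Suc n - 2 * k)) * X ^ (6 * k) * X * X ^ (6 * k)"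
       "X ^ (6 * k + 1) = X ^ (6 * k) * X"
      by (simp_all only: power_add power_one_right)
    show "(1 - X ^ (3 * n + 4)) * (1 - X ^ (3 * n + 3)) * (e (Suc n - 2 * k) * W k) =
        (1 - X ^ (3 * (Suc n - 2 * k))) * e (Suc n - 2 * k) * W k +
        X ^ (3 * (Suc n - 2 * k)) * e (Suc n - 2 * k) * ((1 - X ^ (6 * k)) * (1 - X ^ (6 * k + 1)) * W k) -
        (1 - X ^ (3 * (Suc n - 2 * k))) * e (Suc n - 2 * k) * (X ^ (3 * n + 4 + 6 * k) * W k)"
      unfolding p by (rule ring)
  qed simp
qed

text \<open>Both sides have the same initial values and satisfy the same recurrences, which
  determine them because each \<open>1 - X ^ m\<close> with \<open>m > 0\<close> can be
  cancelled.\<close>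

lemma gf2_solution: "gf2 (3 * n) = asol1 n + asol2 n \<and> gf2 (3 * n + 2) = csol n"
proof (induction n)
  case 0
  have "(1 - X ^ 1) * chain_gf R2 1 = X"
    using gf2_steps(1) [of 0] by (simp add: chain_gf_0)
  then have "(1 - X ^ 1) * gf2 2 = 1"
    by (simp add: chain_gf_0 eval_nat_numeral algebra_simps)
  also have "\<dots> = (1 - X ^ 1) * csol 0"
    using inverse_mult_one_minus_X_power [of 1] by (simp add: csol_def)
  finally have "gf2 2 = csol 0"
    by (rule one_minus_X_power_cancel) simp
  moreover have "gf2 (3 * 0) = asol1 0 + asol2 0"
    by (simp add: asol1_def asol2_def)
  ultimately show ?case
    by (simp only: mult_0_right add_0)
next
  case (Suc n)
  then have IH: "gf2 (3 * n) = asol1 n + asol2 n" "gf2 (3 * n + 2) = csol n"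
    by blast+
  have "(1 - X ^ (3 * n + 2)) * gf2 (3 * Suc n) = (1 - X ^ (3 * n + 2)) * (asol1 (Suc n) + asol2 (Suc n))"
    unfolding gf2_recurrences(1) asol_csol_1 IH ..
  then have a: "gf2 (3 * Suc n) = asol1 (Suc n) + asol2 (Suc n)"
    by (rule one_minus_X_power_cancel) simp
  have "(1 - X ^ (3 * n + 4)) * ((1 - X ^ (3 * n + 3)) * gf2 (3 * Suc n + 2)) =
      (1 - X ^ (3 * n + 4)) * ((1 - X ^ (3 * n + 3)) * csol (Suc n))"
    unfolding mult.assoc [symmetric] gf2_recurrences(2) asol_csol_2 a IH ..
  then have "(1 - X ^ (3 * n + 3)) * gf2 (3 * Suc n + 2) = (1 - X ^ (3 * n + 3)) * csol (Suc n)"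
    by (rule one_minus_X_power_cancel) simp
  then have "gf2 (3 * Suc n + 2) = csol (Suc n)"
    by (rule one_minus_X_power_cancel) simp
  with a show ?case by blast
qed

section \<open>The limit\<close>

text \<open>Convergence is handled by congruences modulo \<open>X ^ N\<close>, that is, by equality
  of the first \<open>N\<close> coefficients.\<close>

definition agree :: "nat \<Rightarrow> rat fps \<Rightarrow> rat fps \<Rightarrow> bool" where
  "agree N f g \<longleftrightarrow> X ^ N dvd f - g"

lemma agree_refl [simp]: "agree N f f"
  by (simp add: agree_def)

lemma agree_trans [trans]: "agree N f g \<Longrightarrow> agree N g h \<Longrightarrow> agree N f h"
  unfolding agree_def by (drule (1) dvd_add) simp

lemma agree_add: "agree N f g \<Longrightarrow> agree N f' g' \<Longrightarrow> agree N (f + f') (g + g')"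
  unfolding agree_def by (drule (1) dvd_add) (simp only: add_diff_add)

lemma agree_sum: "(\<And>k. k \<in> A \<Longrightarrow> agree N (f k) (g k)) \<Longrightarrow> agree N (sum f A) (sum g A)"
  unfolding agree_def by (simp add: sum_subtractf [symmetric] dvd_sum)

lemma agree_mult: "agree N f g \<Longrightarrow> agree N f' g' \<Longrightarrow> agree N (f * f') (g * g')"
proof -
  assume "agree N f g" "agree N f' g'"
  then have "X ^ N dvd (f - g) * f' + g * (f' - g')"
    unfolding agree_def by (intro dvd_add dvd_mult dvd_mult2)
  then show ?thesis
    by (simp add: agree_def algebra_simps)
qed

lemma agree_nth: "agree N f g \<Longrightarrow> i < N \<Longrightarrow> fps_nth f i = fps_nth g i"
proof -
  assume "agree N f g" "i < N"
  then obtain h where "f - g = X ^ N * h" by (auto simp: agree_def)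
  then have "fps_nth (f - g) i = 0"
    using \<open>i < N\<close> by (simp add: fps_X_power_mult_nth)
  then show ?thesis by simp
qed

lemma agree_one_minus: "N \<le> m \<Longrightarrow> agree N (1 - X ^ m) 1"
  by (simp add: agree_def le_imp_power_dvd)

text \<open>\<open>W n\<close> and \<open>W (Suc n)\<close> differ by factors
  \<open>1 - X ^ m\<close> with \<open>m \<ge> 6 n + 5\<close>.\<close>

lemma W_agree: "k \<le> n \<Longrightarrow> agree (6 * k + 5) (W k) (W n)"
proof (induction n rule: dec_induct)
  case (step n)
  have "agree (6 * k + 5) ((1 - X ^ (6 * n + 5)) * (1 - X ^ (6 * n + 6)) * (1 - X ^ (6 * n + 7)) * W (Suc n))
      (1 * 1 * 1 * W (Suc n))"
    using step by (intro agree_mult agree_one_minus agree_refl) auto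
  with step.IH show ?case
    unfolding W_Suc_mult mult_1_left by (rule agree_trans)
qed simp

lemma X_power_dvd_e: "X ^ (3 * (j choose 2)) dvd e j"
proof (induction j)
  case (Suc j)
  have "3 * (Suc j choose 2) = 3 * j + 3 * (j choose 2)"
    by (simp add: numeral_2_eq_2)
  with Suc show ?case
    by (simp add: power_add mult_dvd_mono)
qed simp

text \<open>Replacing \<open>W k\<close> by \<open>W n\<close> changes a summand by
  \<open>e j * (W k - W n)\<close>. Its order is at least \<open>3 * (j choose 2)\<close> from
  \<open>e j\<close> plus \<open>6 * k + 5\<close> from \<open>W_agree\<close>, together at least
  \<open>j + 2 * k = n\<close>.\<close>

lemma csol_agree: "agree n (csol n) ((\<Sum>k\<le>n div 2. e (n - 2 * k)) * W n)"
  unfolding csol_def sum_distrib_right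
proof (rule agree_sum)
  fix k assume "k \<in> {..n div 2}"
  define j where "j = n - 2 * k"
  have n: "n = j + 2 * k" using \<open>k \<in> _\<close> by (auto simp: j_def)
  have "j \<le> 1 + (j choose 2)"
  proof (induction j)
    case (Suc j)
    then show ?case by (cases j) (auto simp: numeral_2_eq_2)
  qed simp
  then have le: "n \<le> 3 * (j choose 2) + (6 * k + 5)" using n by linarith
  have "X ^ (6 * k + 5) dvd W k - W n"
    using W_agree [of k n] n by (simp add: agree_def)
  then have "X ^ (3 * (j choose 2) + (6 * k + 5)) dvd e j * (W k - W n)"
    unfolding power_add [of X "3 * (j choose 2)"] by (rule mult_dvd_mono [OF X_power_dvd_e])
  then show "agree n (e (n - 2 * k) * W k) (e (n - 2 * k) * W n)"
    unfolding agree_def j_def [symmetric] right_diff_distrib [symmetric]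
    by (rule dvd_trans [OF le_imp_power_dvd [OF le]])
qed

section \<open>Euler's product as the limit of the sums over one parity\<close>

text \<open>By \<open>e_Suc_mult\<close>, each \<open>e (Suc j)\<close> splits into the terms
  \<open>Suc j\<close> and \<open>j\<close> of Euler's series at \<open>z = Q\<close>, so indices of
  one parity produce all terms.\<close>

lemma e_sum_parity: "(\<Sum>k\<le>n div 2. e (n - 2 * k)) = (\<Sum>j\<le>n. X ^ (3 * j) * e j)"
proof -
  have step: "e (Suc j) = X ^ (3 * Suc j) * e (Suc j) + X ^ (3 * j) * e j" for j
    using e_Suc_mult [of j] by (simp only: left_diff_distrib mult_1_left diff_eq_eq add.commute)
  show ?thesis
  proof (induction n rule: induct_nat_012)
    case 1
    show ?case using step [of 0] by (simp add: add.commute)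
  next
    case (ge2 n)
    have d: "Suc (Suc n) div 2 = Suc (n div 2)" by simp
    have "(\<Sum>k\<le>Suc (Suc n) div 2. e (Suc (Suc n) - 2 * k)) =
        e (Suc (Suc n)) + (\<Sum>k\<le>n div 2. e (n - 2 * k))"
      unfolding d by (subst sum.atMost_Suc_shift) simp
    also have "\<dots> = (\<Sum>j\<le>Suc (Suc n). X ^ (3 * j) * e j)"
      unfolding ge2(1) by (subst step) (simp only: sum.atMost_Suc add_ac)
    finally show ?case .
  qed simp
qed

text \<open>Truncation of Euler's series for \<open>(-Q ^ (i + 1); Q)\<^sub>\<infinity>\<close>.\<close>

definition S :: "nat \<Rightarrow> nat \<Rightarrow> rat fps" where
  "S i n = (\<Sum>j\<le>n. X ^ (3 * (i * j)) * (X ^ (3 * j) * e j))"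

text \<open>Truncated form of \<open>F(z) = (1 + z) F(Q z)\<close> for Euler's product at
  \<open>z = Q ^ (i + 1)\<close>. The factor \<open>1 - Q ^ j\<close> lowers the index of
  \<open>e\<close>, so the last sum ends one term earlier.\<close>

lemma S_step: "S i (Suc n) = S (Suc i) (Suc n) + X ^ (3 * Suc i) * S (Suc i) n"
proof -
  have "S i (Suc n) - S (Suc i) (Suc n) =
      (\<Sum>j\<le>Suc n. X ^ (3 * (i * j)) * X ^ (3 * j) * ((1 - X ^ (3 * j)) * e j))"
    unfolding S_def sum_subtractf [symmetric]
    by (rule sum.cong) (simp_all add: power_add algebra_simps)
  also have "\<dots> = (\<Sum>j\<le>n. X ^ (3 * (i * Suc j)) * X ^ (3 * Suc j) * (X ^ (3 * j) * e j))"
    by (subst sum.atMost_Suc_shift) (simp only: e_Suc_mult, simp)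
  also have "\<dots> = X ^ (3 * Suc i) * S (Suc i) n"
    unfolding S_def sum_distrib_left
    by (rule sum.cong) (simp_all add: power_add algebra_simps)
  finally show ?thesis by (simp add: algebra_simps)
qed

lemma S_agree_step: "agree n (S i n) ((1 + X ^ (3 * Suc i)) * S (Suc i) n)"
proof (cases n)
  case 0
  then show ?thesis by (simp add: agree_def)
next
  case (Suc m)
  \<comment> \<open>The summand \<open>j = n\<close> missing from \<open>S (Suc i) m\<close> is a
    multiple of \<open>X ^ n\<close>.\<close>
  have "X ^ n dvd X ^ (3 * n)" by (simp add: le_imp_power_dvd)
  then have "agree n 0 (X ^ (3 * (Suc i * n)) * (X ^ (3 * n) * e n))"
    by (simp add: agree_def)
  then have "agree n (S (Suc i) m + 0) (S (Suc i) m + X ^ (3 * (Suc i * n)) * (X ^ (3 * n) * e n))"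
    by (intro agree_add agree_refl)
  then have "agree n (S (Suc i) m) (S (Suc i) n)"
    by (simp only: S_def Suc sum.atMost_Suc add_0_right)
  then have "agree n (S (Suc i) n + X ^ (3 * Suc i) * S (Suc i) m)
      (S (Suc i) n + X ^ (3 * Suc i) * S (Suc i) n)"
    by (intro agree_add agree_mult agree_refl)
  then show ?thesis
    unfolding Suc S_step [of i m] distrib_right mult_1_left .
qed

lemma S_agree_prod: "agree n (S 0 n) ((\<Prod>i<m. 1 + X ^ (3 * Suc i)) * S m n)"
proof (induction m)
  case (Suc m)
  have "agree n ((\<Prod>i<m. 1 + X ^ (3 * Suc i)) * S m n)
      ((\<Prod>i<m. 1 + X ^ (3 * Suc i)) * ((1 + X ^ (3 * Suc m)) * S (Suc m) n))"
    by (intro agree_mult agree_refl S_agree_step)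
  with Suc show ?case
    unfolding prod.lessThan_Suc mult.assoc by (rule agree_trans)
qed simp

lemma S_agree_1: "agree n (S n n) 1"
proof -
  have "agree n (X ^ (3 * (n * j)) * (X ^ (3 * j) * e j)) (if j = 0 then 1 else 0)" for j
  proof (cases "j = 0")
    case False
    then have "n \<le> 3 * (n * j)" by (cases j) auto
    then show ?thesis
      using False by (simp add: agree_def le_imp_power_dvd)
  qed simp
  then have "agree n (S n n) (\<Sum>j\<le>n. if j = 0 then 1 else 0)"
    unfolding S_def by (intro agree_sum)
  then show ?thesis by simp
qed

lemma e_sum_agree: "agree n (\<Sum>k\<le>n div 2. e (n - 2 * k)) (\<Prod>i<n. 1 + X ^ (3 * Suc i))"
proof -
  have "agree n (S 0 n) ((\<Prod>i<n. 1 + X ^ (3 * Suc i)) * S n n)"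
    by (rule S_agree_prod)
  also have "agree n ((\<Prod>i<n. 1 + X ^ (3 * Suc i)) * S n n) ((\<Prod>i<n. 1 + X ^ (3 * Suc i)) * 1)"
    by (intro agree_mult agree_refl S_agree_1)
  finally show ?thesis
    by (simp add: S_def e_sum_parity)
qed

section \<open>Euler's identity for odd and distinct parts, in multiples of 3\<close>

lemma euler_odd_distinct_finite:
  "(\<Prod>i<n. 1 - X ^ (6 * i + 3)) * (\<Prod>i<n. 1 + X ^ (3 * Suc i)) * (\<Prod>i<n. 1 - X ^ (3 * Suc i)) =
    (\<Prod>i<2 * n. 1 - X ^ (3 * Suc i))"
proof (induction n)
  case (Suc n)
  \<comment> \<open>Of the two new factors on the right, \<open>1 - X ^ (6 * n + 6)\<close> splits
    as a difference of squares; the other is \<open>1 - X ^ (6 * n + 3)\<close>.\<close>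
  have s: "(1 + X ^ (3 * Suc n)) * (1 - X ^ (3 * Suc n)) = 1 - X ^ (3 * Suc (Suc (2 * n)))"
    by (simp add: algebra_simps power_add [symmetric])
  have i: "2 * Suc n = Suc (Suc (2 * n))" "3 * Suc (2 * n) = 6 * n + 3" by simp_all
  have "(\<Prod>i<2 * Suc n. 1 - X ^ (3 * Suc i)) = (\<Prod>i<2 * n. 1 - X ^ (3 * Suc i)) *
      (1 - X ^ (6 * n + 3)) * ((1 + X ^ (3 * Suc n)) * (1 - X ^ (3 * Suc n)))"
    unfolding s i(1) prod.lessThan_Suc i(2) ..
  then show ?case
    unfolding Suc [symmetric] prod.lessThan_Suc by (simp only: mult_ac)
qed simp

text \<open>Cancelling \<open>n\<close> factors in the finite identity leaves
  \<open>1 - X ^ (3 * Suc (n + i))\<close> for \<open>i < n\<close>, each \<open>1\<close> modulo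
  \<open>X ^ n\<close>.\<close>

lemma odd_distinct_agree:
  "agree n ((\<Prod>i<n. 1 - X ^ (6 * i + 3)) * (\<Prod>i<n. 1 + X ^ (3 * Suc i))) 1"
proof -
  have split: "(\<Prod>i<n + m. 1 - X ^ (3 * Suc i)) =
      (\<Prod>i<m. 1 - X ^ (3 * Suc (n + i))) * (\<Prod>i<n. 1 - X ^ (3 * Suc i))" for m
    by (induction m) (simp_all add: mult_ac)
  have nz: "(\<Prod>i<n. 1 - X ^ (3 * Suc i)) \<noteq> 0"
    using one_minus_X_power_neq_0 by simp
  have "(\<Prod>i<n. 1 - X ^ (6 * i + 3)) * (\<Prod>i<n. 1 + X ^ (3 * Suc i)) = (\<Prod>i<n. 1 - X ^ (3 * Suc (n + i)))"
    using euler_odd_distinct_finite [of n] split [of n] nz by (simp add: mult_2)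
  moreover have "agree n (\<Prod>i<m. 1 - X ^ (3 * Suc (n + i))) 1" for m
  proof (induction m)
    case (Suc m)
    have "agree n ((\<Prod>i<m. 1 - X ^ (3 * Suc (n + i))) * (1 - X ^ (3 * Suc (n + m)))) (1 * 1)"
      using Suc by (intro agree_mult agree_one_minus) auto
    then show ?case by simp
  qed simp
  ultimately show ?thesis by simp
qed

section \<open>Comparison of the two generating functions\<close>

text \<open>\<open>gf1 (6 * n + 2)\<close> is the product of \<open>1 / (1 - X ^ m)\<close> over the
  admissible \<open>m \<le> 6 n + 1\<close>. The left factor cancels residue \<open>3\<close>;
  \<open>W n\<close> holds residues \<open>0\<close>, \<open>1\<close> and \<open>5\<close>.\<close>

lemma gf1_W: "(\<Prod>i<n. 1 - X ^ (6 * i + 3)) * gf1 (6 * n + 2) = W n"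
proof (induction n)
  case 0
  have "(1 - X ^ 1) * gf1 2 = 1"
    using gf1_step(1) [of 1] by (simp add: chain_gf_0 numeral_2_eq_2)
  also have "\<dots> = (1 - X ^ 1) * W 0"
    using inverse_mult_one_minus_X_power [of 1] by simp
  finally have "gf1 2 = W 0"
    by (rule one_minus_X_power_cancel) simp
  then show ?case
    by (simp only: lessThan_0 prod.empty mult_0_right add_0 mult_1_left)
next
  case (Suc n)
  let ?d = "(1 - X ^ (6 * n + 5)) * (1 - X ^ (6 * n + 6)) * (1 - X ^ (6 * n + 7))"
  have "?d * ((\<Prod>i<Suc n. 1 - X ^ (6 * i + 3)) * gf1 (6 * Suc n + 2)) =
     (\<Prod>i<n. 1 - X ^ (6 * i + 3)) * ((1 - X ^ (6 * n + 3)) * (1 - X ^ (6 * n + 5)) *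
      (1 - X ^ (6 * n + 6)) * (1 - X ^ (6 * n + 7)) * gf1 (6 * Suc n + 2))"
    unfolding prod.lessThan_Suc by (simp only: mult_ac)
  also have "\<dots> = ?d * W (Suc n)"
    unfolding gf1_6_step Suc W_Suc_mult ..
  finally have "?d * ((\<Prod>i<Suc n. 1 - X ^ (6 * i + 3)) * gf1 (6 * Suc n + 2)) = ?d * W (Suc n)" .
  moreover have "?d \<noteq> 0"
    unfolding mult_eq_0_iff using one_minus_X_power_neq_0 by simp
  ultimately show ?case
    by (rule mult_left_cancel [THEN iffD1, rotated])
qed

lemma gf1_gf2_agree: "agree n (gf2 (3 * n + 2)) (gf1 (6 * n + 2))"
proof -
  let ?O = "\<Prod>i<n. 1 - X ^ (6 * i + 3)" and ?D = "\<Prod>i<n. 1 + X ^ (3 * Suc i)"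
  have "agree n (csol n) ((\<Sum>k\<le>n div 2. e (n - 2 * k)) * W n)"
    by (rule csol_agree)
  also have "agree n ((\<Sum>k\<le>n div 2. e (n - 2 * k)) * W n) (?D * W n)"
    by (intro agree_mult agree_refl e_sum_agree)
  also have "?D * W n = ?O * ?D * gf1 (6 * n + 2)"
    unfolding gf1_W [symmetric] by (simp only: mult_ac)
  also have "agree n (?O * ?D * gf1 (6 * n + 2)) (1 * gf1 (6 * n + 2))"
    by (intro agree_mult agree_refl odd_distinct_agree)
  finally show ?thesis
    by (simp only: gf2_solution mult_1_left)
qed

theorem theorem1p3:
  fixes n :: nat
  shows "C1 n = C2 n"
proof -
  \<comment> \<open>\<open>Suc n\<close> is taken because agreement modulo \<open>X ^ n\<close>
    covers only the coefficients below \<open>n\<close>.\<close>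
  have "(of_nat (C1 n) :: rat) = fps_nth (gf1 (6 * Suc n + 2)) n"
    by (rule C1_eq) simp
  also have "\<dots> = fps_nth (gf2 (3 * Suc n + 2)) n"
    by (rule agree_nth [OF gf1_gf2_agree lessI, symmetric])
  also have "\<dots> = of_nat (C2 n)"
    by (rule C2_eq [symmetric]) simp
  finally show ?thesis
    by (simp only: of_nat_eq_iff)
qed

end
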